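(* Let $\Pi$ be an arbitrary $\mathbf 0$-symmetric parallelepiped in $\mathbb R^3$, with pseudo-compound parallelepiped $\Pi^\ast$. Suppose that \[ \mu_1(\Pi^\ast,\mathbb Z^3)\le 1\quad\text{and}\quad \mu_1(\Pi,\mathbb Z^3)>1. \] Then \[ \mu_1(\Pi,\mathbb Z^3)\le \frac{2}{\sqrt3}\quad\text{and}\quad \mu_2(\Pi,\mathbb Z^3)\le\frac54. \] Moreover, the constants $2/\sqrt3$ and $5/4$ are exact, i.e. neither of them can be replaced by a smaller constant.
   Context: Successive minima: for a convex body $M\subset\mathbb R^d$ symmetric with respect to the origin and a $d$-dimensional (full rank) lattice $\Lambda\subset\mathbb R^d$, the $k$-th successive minimum $\mu_k(M,\Lambda)$ is the minimal positive $\mu$ such that $\mu M$ contains $k$ linearly independent points of $\Lambda$. Pseudo-compound parallelepiped (here $d=3$): every $\mathbf 0$-symmetric (closed, non-degenerate) parallelepiped in $\mathbb R^d$ can be written as $\Pi=\{\mathbf z\in\mathbb R^d : |h_i(\mathbf z)|\le\eta_i,\ i=1,\ldots,d\}$ with positive numbers $\eta_1,\ldots,\eta_d$ and linear forms $h_1,\ldots,h_d$ on $\mathbb R^d$ whose coefficient matrix $H$ (rows are the forms) has $\det H=1$. Let $h_1^\ast,\ldots,h_d^\ast$ be the dual set of linear forms, i.e. $\langle h_i,h_j^\ast\rangle=\delta_{ij}$ where forms are identified with their coefficient vectors and $\langle\cdot,\cdot\rangle$ is the standard inner product. The pseudo-compound of $\Pi$ is \[ \Pi^\ast=\Big\{\mathbf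 z\in\mathbb R^d : |h_i^\ast(\mathbf z)|\le\frac1{\eta_i}\prod_{j=1}^d\eta_j,\ i=1,\ldots,d\Big\}. \] *)

theory Defs
  imports "HOL-Analysis.Analysis"
begin

definition integer_lattice :: "(real^'n) set" where
  "integer_lattice = {z. \<forall>i. z $ i \<in> \<int>}"

text \<open>For a symmetric convex body and a full rank lattice (and \<open>k\<close> between 1 and the dimension) the
  set below is nonempty and has a least element, so the infimum is the minimal positive factor.\<close>
definition successive_minimum :: "nat \<Rightarrow> ('a::real_vector) set \<Rightarrow> 'a set \<Rightarrow> real" where
  "successive_minimum k M \<Lambda> =
     Inf {\<mu>. 0 < \<mu> \<and> (\<exists>S. S \<subseteq> (\<lambda>x. \<mu> *\<^sub>R x) ` M \<inter> \<Lambda> \<and> independent S \<and> card S = k)}"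

definition symmetric_parallelepiped :: "(real^'n) set \<Rightarrow> bool" where
  "symmetric_parallelepiped P \<longleftrightarrow>
     (\<exists>A::real^'n^'n. invertible A \<and> P = {A *v t |t. \<forall>i. \<bar>t $ i\<bar> \<le> 1})"

definition form_box :: "real^'n^'n \<Rightarrow> ('n \<Rightarrow> real) \<Rightarrow> (real^'n) set" where
  "form_box H \<eta> = {z. \<forall>i. \<bar>row i H \<bullet> z\<bar> \<le> \<eta> i}"

definition dual_forms :: "real^'n^'n \<Rightarrow> real^'n^'n \<Rightarrow> bool" where
  "dual_forms H G \<longleftrightarrow> (\<forall>i j. row i H \<bullet> row j G = (if i = j then 1 else 0))"

text \<open>The pseudo-compound is read off from a representation of \<open>P\<close> by forms of determinant 1. Every
  symmetric parallelepiped has one (lemma \<open>symmetric_parallelepiped_iff\<close>), and the result does not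
  depend on its choice (lemma \<open>pseudo_compound_form_box\<close>).\<close>
definition pseudo_compound :: "(real^'n) set \<Rightarrow> (real^'n) set" where
  "pseudo_compound P =
     (THE Q. \<exists>H G \<eta>. det H = 1 \<and> dual_forms H G \<and> (\<forall>i. 0 < \<eta> i) \<and>
        P = form_box H \<eta> \<and> Q = form_box G (\<lambda>i. 1 / \<eta> i * (\<Prod>j\<in>UNIV. \<eta> j)))"

lemma dual_forms_matrix: "dual_forms H G \<longleftrightarrow> H ** transpose G = mat 1"
  unfolding dual_forms_def vec_eq_iff
  by (simp add: matrix_matrix_mult_def transpose_def mat_def row_def inner_vec_def)

lemma dual_forms_sym: "dual_forms H G \<Longrightarrow> dual_forms G H"
  unfolding dual_forms_def by (metis inner_commute)

lemma dual_forms_exists: "det H \<noteq> 0 \<Longrightarrow> \<exists>G. dual_forms H G"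
  unfolding dual_forms_matrix
  by (metis invertible_det_nz invertible_right_inverse transpose_transpose)

lemma dual_forms_expansion:
  assumes "dual_forms H G"
  shows "z = (\<Sum>i\<in>UNIV. (row i H \<bullet> z) *\<^sub>R row i G)"
proof -
  have "transpose G ** H = mat 1"
    using assms unfolding dual_forms_matrix by (simp add: matrix_left_right_inverse)
  then have "z = transpose G *v (H *v z)"
    by (simp add: matrix_vector_mul_assoc)
  also have "\<dots> = (\<Sum>i\<in>UNIV. (row i H \<bullet> z) *\<^sub>R row i G)"
    by (subst matrix_mult_sum) (simp add: column_transpose matrix_vector_mul_component row_def vec_nth_inverse scalar_mult_eq_scaleR)
  finally show ?thesis .
qed

lemma biorthogonal_box_facet:
  fixes a b a' b' :: "'n::finite \<Rightarrow> real^'n"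
  assumes ab: "\<And>i j. a i \<bullet> b j = (if i = j then 1 else 0)"
    and ab': "\<And>i j. a' i \<bullet> b' j = (if i = j then 1 else 0)"
    and ex: "\<And>z. z = (\<Sum>i\<in>UNIV. (b i \<bullet> z) *\<^sub>R a i)"
    and ex': "\<And>z. z = (\<Sum>i\<in>UNIV. (b' i \<bullet> z) *\<^sub>R a' i)"
    and eq: "{z. \<forall>i. \<bar>a i \<bullet> z\<bar> \<le> 1} = {z. \<forall>i. \<bar>a' i \<bullet> z\<bar> \<le> 1}"
  shows "\<exists>k. a' k = a i \<or> a' k = - a i"
proof -
  define C where "C = (\<lambda>k. b' k \<bullet> a i)"
  define D where "D = (\<lambda>k l. b l \<bullet> a' k)"
  have C: "(\<Sum>k\<in>UNIV. \<bar>C k\<bar>) \<le> 1"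
  proof -
    define z where "z = (\<Sum>k\<in>UNIV. sgn (C k) *\<^sub>R b' k)"
    have "a' l \<bullet> z = sgn (C l)" for l
      unfolding z_def by (simp add: inner_sum_right ab' if_distrib cong: if_cong)
    then have "z \<in> {z. \<forall>i. \<bar>a' i \<bullet> z\<bar> \<le> 1}" by (auto simp: sgn_if)
    with eq have "\<bar>a i \<bullet> z\<bar> \<le> 1" by blast
    moreover have "a i \<bullet> z = (\<Sum>k\<in>UNIV. \<bar>C k\<bar>)"
      unfolding z_def inner_sum_right
      by (rule sum.cong) (simp_all add: C_def inner_commute sgn_mult_self_eq abs_sgn mult.commute)
    ultimately show ?thesis by linarith
  qed
  have D: "(\<Sum>l\<in>UNIV. \<bar>D k l\<bar>) \<le> 1" for k
  proof -
    define z where "z = (\<Sum>l\<in>UNIV. sgn (D k l) *\<^sub>R b l)"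
    have "a l \<bullet> z = sgn (D k l)" for l
      unfolding z_def by (simp add: inner_sum_right ab if_distrib cong: if_cong)
    then have "z \<in> {z. \<forall>i. \<bar>a i \<bullet> z\<bar> \<le> 1}" by (auto simp: sgn_if)
    with eq have "\<bar>a' k \<bullet> z\<bar> \<le> 1" by blast
    moreover have "a' k \<bullet> z = (\<Sum>l\<in>UNIV. \<bar>D k l\<bar>)"
      unfolding z_def inner_sum_right
      by (rule sum.cong) (simp_all add: D_def inner_commute abs_sgn mult.commute)
    ultimately show ?thesis by linarith
  qed
  have Dle: "\<bar>D k l\<bar> \<le> 1" for k l
    using member_le_sum[of l UNIV "\<lambda>l. \<bar>D k l\<bar>"] D[of k] by simp
  have "1 = b i \<bullet> a i" using ab[of i i] by (simp add: inner_commute)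
  also have "\<dots> = (\<Sum>k\<in>UNIV. C k * D k i)"
    by (subst ex'[of "a i"]) (simp add: inner_sum_right C_def D_def)
  finally have one: "(\<Sum>k\<in>UNIV. C k * D k i) = 1" by simp
  have "\<exists>k. \<bar>D k i\<bar> = 1"
  proof (rule ccontr)
    assume "\<not> ?thesis"
    then have lt: "\<bar>D k i\<bar> < 1" for k using Dle[of k i] by (metis less_le)
    obtain k0 where k0: "C k0 \<noteq> 0" using one by fastforce
    have "(\<Sum>k\<in>UNIV. C k * D k i) < (\<Sum>k\<in>UNIV. \<bar>C k\<bar>)"
    proof (rule sum_strict_mono_ex1)
      show "\<forall>k\<in>UNIV. C k * D k i \<le> \<bar>C k\<bar>"
      proof
        fix k
        have "C k * D k i \<le> \<bar>C k\<bar> * \<bar>D k i\<bar>" by (metis abs_ge_self abs_mult)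
        also have "\<dots> \<le> \<bar>C k\<bar> * 1" using Dle[of k i] by (intro mult_left_mono) auto
        finally show "C k * D k i \<le> \<bar>C k\<bar>" by simp
      qed
      have "C k0 * D k0 i \<le> \<bar>C k0\<bar> * \<bar>D k0 i\<bar>" by (metis abs_ge_self abs_mult)
      also have "\<dots> < \<bar>C k0\<bar> * 1" using k0 lt[of k0] by (intro mult_strict_left_mono) auto
      finally show "\<exists>k\<in>UNIV. C k * D k i < \<bar>C k\<bar>" by auto
    qed simp
    with one C show False by linarith
  qed
  then obtain k where k: "\<bar>D k i\<bar> = 1" ..
  have "\<bar>D k i\<bar> + (\<Sum>l\<in>UNIV - {i}. \<bar>D k l\<bar>) \<le> 1"
    using D[of k] by (simp add: sum.remove[of UNIV i])
  with k have "(\<Sum>l\<in>UNIV - {i}. \<bar>D k l\<bar>) \<le> 0" by linarith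
  then have "(\<Sum>l\<in>UNIV - {i}. \<bar>D k l\<bar>) = 0" by (meson abs_ge_zero antisym sum_nonneg)
  then have z: "D k l = 0" if "l \<noteq> i" for l
    using that by (subst (asm) sum_nonneg_eq_0_iff) auto
  have "a' k = (\<Sum>l\<in>UNIV. D k l *\<^sub>R a l)" unfolding D_def by (rule ex)
  also have "\<dots> = D k i *\<^sub>R a i" using z by (simp add: sum.remove[of UNIV i])
  finally show ?thesis using k by (auto simp: abs_if split: if_splits)
qed

lemma pseudo_compound_unique:
  fixes H H' :: "real^'n^'n"
  assumes "det H = 1" "det H' = 1" and du: "dual_forms H G" "dual_forms H' G'"
    and pos: "\<And>i. 0 < \<eta> i" "\<And>i. 0 < \<eta>' i"
    and eq: "form_box H \<eta> = form_box H' \<eta>'"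
  shows "form_box G (\<lambda>i. 1 / \<eta> i * prod \<eta> UNIV) = form_box G' (\<lambda>i. 1 / \<eta>' i * prod \<eta>' UNIV)"
proof -
  define a where "a = (\<lambda>i. (1 / \<eta> i) *\<^sub>R row i H)"
  define a' where "a' = (\<lambda>i. (1 / \<eta>' i) *\<^sub>R row i H')"
  define b where "b = (\<lambda>i. \<eta> i *\<^sub>R row i G)"
  define b' where "b' = (\<lambda>i. \<eta>' i *\<^sub>R row i G')"
  have nz: "\<eta> i \<noteq> 0" "\<eta>' i \<noteq> 0" for i using pos[of i] by auto
  have ab: "a i \<bullet> b j = (if i = j then 1 else 0)" for i j
    using du(1) nz by (simp add: a_def b_def dual_forms_def)
  have ab': "a' i \<bullet> b' j = (if i = j then 1 else 0)" for i j
    using du(2) nz by (simp add: a'_def b'_def dual_forms_def)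
  have ex: "z = (\<Sum>i\<in>UNIV. (b i \<bullet> z) *\<^sub>R a i)" for z
    using dual_forms_expansion[OF dual_forms_sym[OF du(1)], of z] nz by (simp add: a_def b_def)
  have ex': "z = (\<Sum>i\<in>UNIV. (b' i \<bullet> z) *\<^sub>R a' i)" for z
    using dual_forms_expansion[OF dual_forms_sym[OF du(2)], of z] nz by (simp add: a'_def b'_def)
  have exb: "z = (\<Sum>i\<in>UNIV. (a i \<bullet> z) *\<^sub>R b i)" for z
    using dual_forms_expansion[OF du(1), of z] nz by (simp add: a_def b_def)
  have P: "form_box H \<eta> = {z. \<forall>i. \<bar>a i \<bullet> z\<bar> \<le> 1}"
    unfolding form_box_def a_def using pos by (simp add: abs_mult field_simps less_imp_le)
  have P': "form_box H' \<eta>' = {z. \<forall>i. \<bar>a' i \<bullet> z\<bar> \<le> 1}"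
    unfolding form_box_def a'_def using pos by (simp add: abs_mult field_simps less_imp_le)
  have "\<exists>k. a' k = a i \<or> a' k = - a i" for i
    by (rule biorthogonal_box_facet[OF ab ab' ex ex']) (use eq P P' in simp)
  then obtain f where f: "\<And>i. a' (f i) = a i \<or> a' (f i) = - a i" by metis
  define s :: "'n \<Rightarrow> real" where "s = (\<lambda>i. if a' (f i) = a i then 1 else - 1)"
  have s: "a' (f i) = s i *\<^sub>R a i" for i using f[of i] by (auto simp: s_def)
  have ss: "s i * s i = 1" "\<bar>s i\<bar> = 1" for i by (auto simp: s_def)
  have "inj f"
  proof (rule injI, rule ccontr)
    fix i j assume h: "f i = f j" "i \<noteq> j"
    then have "s i *\<^sub>R a i = s j *\<^sub>R a j" using s by metis
    then have "(s i *\<^sub>R a i) \<bullet> b i = (s j *\<^sub>R a j) \<bullet> b i" by simp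
    then show False using h ab[of i i] ab[of j i] ss(2)[of i] by auto
  qed
  then have bij: "bij f" by (simp add: finite_UNIV_inj_surj bij_def)
  then have perm: "f permutes UNIV" by (simp add: permutes_def bij_iff)
  have b's: "b' (f i) = s i *\<^sub>R b i" for i
  proof -
    have "a j \<bullet> b' (f i) = s j * (a' (f j) \<bullet> b' (f i))" for j
      using ss(1)[of j] by (simp add: s mult.assoc[symmetric])
    then have "a j \<bullet> b' (f i) = (if j = i then s i else 0)" for j
      using \<open>inj f\<close> by (simp add: ab' inj_eq)
    then have "b' (f i) = (\<Sum>j\<in>UNIV. (if j = i then s i else 0) *\<^sub>R b j)"
      using exb[of "b' (f i)"] by simp
    also have "\<dots> = (\<Sum>j\<in>UNIV. (if j = i then s i *\<^sub>R b j else 0))"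
      by (rule sum.cong) auto
    also have "\<dots> = s i *\<^sub>R b i" by simp
    finally show ?thesis .
  qed
  have dM: "det (\<chi> i. a i) = (\<Prod>i\<in>UNIV. 1 / \<eta> i)"
  proof -
    have "(\<chi> i. a i) = (\<chi> i. (1 / \<eta> i) *s (H $ i))"
      by (simp add: a_def row_def scalar_mult_eq_scaleR vec_eq_iff)
    then show ?thesis using assms(1) by (simp add: det_rows_mul)
  qed
  have dM': "det (\<chi> i. a' i) = (\<Prod>i\<in>UNIV. 1 / \<eta>' i)"
  proof -
    have "(\<chi> i. a' i) = (\<chi> i. (1 / \<eta>' i) *s (H' $ i))"
      by (simp add: a'_def row_def scalar_mult_eq_scaleR vec_eq_iff)
    then show ?thesis using assms(2) by (simp add: det_rows_mul)
  qed
  have "\<bar>det (\<chi> i. a' i)\<bar> = \<bar>det (\<chi> i. (\<chi> i. a' i) $ f i)\<bar>"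
    using perm by (simp only: det_permute_rows abs_mult) (simp add: sign_def)
  also have "(\<chi> i. (\<chi> i. a' i) $ f i) = (\<chi> i. s i *s a i)"
    by (simp add: s scalar_mult_eq_scaleR)
  also have "\<bar>det \<dots>\<bar> = \<bar>det (\<chi> i. a i)\<bar>"
    by (simp add: det_rows_mul abs_mult abs_prod ss)
  finally have pe: "prod \<eta>' UNIV = prod \<eta> UNIV"
    unfolding dM dM' using pos by (simp add: prod_dividef abs_prod abs_of_pos)
  have Q: "form_box G (\<lambda>i. 1 / \<eta> i * prod \<eta> UNIV) = {z. \<forall>i. \<bar>b i \<bullet> z\<bar> \<le> prod \<eta> UNIV}"
    unfolding form_box_def b_def using pos by (simp add: abs_mult field_simps abs_of_pos)
  have Q': "form_box G' (\<lambda>i. 1 / \<eta>' i * prod \<eta>' UNIV) = {z. \<forall>i. \<bar>b' i \<bullet> z\<bar> \<le> prod \<eta>' UNIV}"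
    unfolding form_box_def b'_def using pos by (simp add: abs_mult field_simps abs_of_pos)
  have "(\<forall>i. \<bar>b' i \<bullet> z\<bar> \<le> c) \<longleftrightarrow> (\<forall>i. \<bar>b i \<bullet> z\<bar> \<le> c)" for z c
  proof -
    have "(\<forall>i. \<bar>b' i \<bullet> z\<bar> \<le> c) \<longleftrightarrow> (\<forall>i. \<bar>b' (f i) \<bullet> z\<bar> \<le> c)"
      using bij by (metis bij_pointE)
    then show ?thesis by (simp add: b's abs_mult ss)
  qed
  then show ?thesis unfolding Q Q' unfolding pe by simp
qed

lemma pseudo_compound_form_box:
  assumes "det H = 1" "dual_forms H G" "\<And>i. 0 < \<eta> i"
  shows "pseudo_compound (form_box H \<eta>) = form_box G (\<lambda>i. 1 / \<eta> i * (\<Prod>j\<in>UNIV. \<eta> j))"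
  unfolding pseudo_compound_def
proof (rule the_equality)
  fix Q assume "\<exists>H' G' \<eta>'. det H' = 1 \<and> dual_forms H' G' \<and> (\<forall>i. 0 < \<eta>' i) \<and>
        form_box H \<eta> = form_box H' \<eta>' \<and> Q = form_box G' (\<lambda>i. 1 / \<eta>' i * (\<Prod>j\<in>UNIV. \<eta>' j))"
  then obtain H' G' \<eta>' where "det H' = 1" "dual_forms H' G'" "\<And>i. 0 < \<eta>' i"
      "form_box H \<eta> = form_box H' \<eta>'" and Q: "Q = form_box G' (\<lambda>i. 1 / \<eta>' i * (\<Prod>j\<in>UNIV. \<eta>' j))"
    by blast
  then show "Q = form_box G (\<lambda>i. 1 / \<eta> i * (\<Prod>j\<in>UNIV. \<eta> j))"
    unfolding Q using pseudo_compound_unique[of H H' G G' \<eta> \<eta>'] assms by simp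
qed (use assms in blast)

lemma parallelepiped_as_form_box:
  fixes A B :: "real^'n^'n"
  assumes "A ** B = mat 1"
  shows "{A *v t |t. \<forall>i. \<bar>t $ i\<bar> \<le> 1} = form_box B (\<lambda>_. 1)"
proof -
  have BA: "B ** A = mat 1" using assms by (simp add: matrix_left_right_inverse)
  have "z \<in> {A *v t |t. \<forall>i. \<bar>t $ i\<bar> \<le> 1} \<longleftrightarrow> (\<forall>i. \<bar>(B *v z) $ i\<bar> \<le> 1)" for z
  proof
    assume "\<forall>i. \<bar>(B *v z) $ i\<bar> \<le> 1"
    moreover have "z = A *v (B *v z)" using assms by (simp add: matrix_vector_mul_assoc)
    ultimately show "z \<in> {A *v t |t. \<forall>i. \<bar>t $ i\<bar> \<le> 1}" by blast
  qed (use BA in \<open>auto simp: matrix_vector_mul_assoc\<close>)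
  then show ?thesis
    unfolding form_box_def by (auto simp: matrix_vector_mul_component row_def)
qed

lemma symmetric_parallelepiped_iff:
  fixes P :: "(real^'n) set"
  shows "symmetric_parallelepiped P \<longleftrightarrow>
    (\<exists>(H::real^'n^'n) \<eta>. det H = 1 \<and> (\<forall>i. 0 < \<eta> i) \<and> P = form_box H \<eta>)"
proof
  assume "symmetric_parallelepiped P"
  then obtain A B :: "real^'n^'n" where AB: "A ** B = mat 1"
    and PA: "P = {A *v t |t. \<forall>i. \<bar>t $ i\<bar> \<le> 1}"
    unfolding symmetric_parallelepiped_def invertible_def by blast
  have P: "P = form_box B (\<lambda>_. 1)" unfolding PA by (rule parallelepiped_as_form_box[OF AB])
  have d: "det B \<noteq> 0" using AB by (metis invertible_def invertible_det_nz matrix_left_right_inverse)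
  define c :: "'n \<Rightarrow> real" where "c = (\<lambda>i. if i = undefined then 1 / det B else 1)"
  define H where "H = (\<chi> i. c i *s (B $ i))"
  have c: "c i \<noteq> 0" for i using d by (simp add: c_def)
  have "det H = 1" using d unfolding H_def det_rows_mul by (simp add: c_def)
  moreover have "P = form_box H (\<lambda>i. \<bar>c i\<bar>)"
    unfolding P form_box_def H_def row_def using c
    by (simp add: scalar_mult_eq_scaleR abs_mult)
  ultimately show "\<exists>(H::real^'n^'n) \<eta>. det H = 1 \<and> (\<forall>i. 0 < \<eta> i) \<and> P = form_box H \<eta>"
    using c by (intro exI[of _ H] exI[of _ "\<lambda>i. \<bar>c i\<bar>"]) simp
next
  assume "\<exists>(H::real^'n^'n) \<eta>. det H = 1 \<and> (\<forall>i. 0 < \<eta> i) \<and> P = form_box H \<eta>"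
  then obtain H :: "real^'n^'n" and \<eta> where
    H: "det H = 1" and pos: "\<And>i. 0 < \<eta> i" and P: "P = form_box H \<eta>" by blast
  define B where "B = (\<chi> i. (1 / \<eta> i) *s (H $ i))"
  have "P = form_box B (\<lambda>_. 1)"
    unfolding P form_box_def B_def row_def using pos
    by (simp add: scalar_mult_eq_scaleR abs_mult field_simps abs_of_pos)
  moreover have "det B \<noteq> 0"
    unfolding B_def det_rows_mul using H pos by (simp add: less_imp_neq[symmetric])
  then obtain A where "A ** B = mat 1" "B ** A = mat 1"
    unfolding invertible_det_nz[symmetric] invertible_def by blast
  ultimately show "symmetric_parallelepiped P"
    unfolding symmetric_parallelepiped_def invertible_def
    using parallelepiped_as_form_box[of A B] by blast
qed

end

theory Submission
  imports Defs
begin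

text \<open>
  Write the parallelepiped as \<open>P = {z. \<forall>i. \<bar>b\<^sub>i \<bullet> z\<bar> \<le> 1}\<close>. The pseudo-compound is then the box of the
  \<open>2 \<times> 2\<close> minors: it consists of all \<open>w\<close> with \<open>\<bar>(b\<^sub>i \<times> b\<^sub>j) \<bullet> w\<bar> \<le> 1\<close> for all \<open>i < j\<close>
  (\<open>pseudo_compound_unit_box\<close>). A nonzero integer point \<open>w\<close> in it cuts out the planar lattice
  \<open>L = {z \<in> \<int>\<^sup>3. w \<bullet> z = 0}\<close>. In the coordinates \<open>b\<^sub>i \<bullet> z\<close>, the three minors \<open>(b\<^sub>i \<times> b\<^sub>j) \<bullet> w\<close> bound
  in modulus the covolumes of the projections of \<open>L\<close> to the coordinate planes, with equality if
  \<open>w\<close> is primitive. Project to the plane for which the minor is largest. On \<open>L\<close> the omitted coordinate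
  is then a linear combination of the two others with coefficients in \<open>[-1, 1]\<close>, so that, after a choice of signs,
  the section of \<open>P\<close> contains the hexagon \<open>\<bar>x\<bar>, \<bar>y\<bar>, \<bar>x + y\<bar> \<le> 1\<close>. What remains is a planar
  problem about this hexagon and a lattice of covolume at most 1.

  Let \<open>u\<close> be a shortest vector of \<open>L\<close> in the hexagonal norm, of length \<open>a\<close>. The point is that
  for \<open>r \<ge> a\<close> the hexagon of radius \<open>r\<close> contains a segment that is a translate of \<open>[0, u]\<close> and
  lies at "height" \<open>det(u, \<cdot>) = a r - s (a - s) \<ge> a r - a\<^sup>2 / 4\<close>, where \<open>s\<close> and \<open>a - s\<close> are the
  two smaller of the three coordinate moduli of \<open>u\<close>. If \<open>a r - a\<^sup>2 / 4 \<ge> 1\<close>, convexity gives such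
  a segment at every smaller height as well, in particular on a line \<open>v + \<real> u\<close> with \<open>v \<in> L\<close> and
  \<open>\<bar>det(u, v)\<bar> \<le> 1\<close>; and a segment of that length on this line meets \<open>v + \<int> u\<close>
  (\<open>hex_chord\<close>). Taking \<open>r = a\<close> contradicts the minimality of \<open>a\<close> as soon as \<open>3 a\<^sup>2 / 4 > 1\<close>, hence \<open>a \<le> 2 / \<surd>3\<close>. Taking \<open>r = 5 / 4\<close> is possible
  because \<open>5 a / 4 - a\<^sup>2 / 4 - 1 = (a - 1) (4 - a) / 4\<close> is positive when \<open>1 < a < 4\<close>, and \<open>a > 1\<close>
  follows from the assumption on the first minimum; this gives the second independent vector
  (\<open>planar_lattice_short_vectors\<close>).

  Both constants come from the same inequality, and so do the extremal examples: for
  \<open>1 \<le> a \<le> 2 / \<surd>3\<close> and \<open>r = 1 / a + a / 4\<close> the planar lattice spanned by \<open>(a, -a/2)\<close> and \<open>(-a/2, r)\<close> has covolume 1 and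
  minima \<open>a\<close> and \<open>r\<close>; one places it in the plane \<open>x + y + z = 0\<close> and completes it by a distant third
  vector (\<open>extremal_parallelepiped\<close>). The choice \<open>a = r = 2 / \<surd>3\<close> attains the first constant, and
  \<open>r\<close> tends to \<open>5 / 4\<close> as \<open>a\<close> decreases to 1.
\<close>

unbundle cross3_syntax

section \<open>Chords of the regular hexagon\<close>

text \<open>With \<open>z = - (x + y)\<close> this is the maximum norm on the plane \<open>x + y + z = 0\<close>, which has the full
  symmetry group of the hexagon; every coordinate permutation and the central symmetry preserve
  determinants up to sign.\<close>
definition hex_norm :: "real \<Rightarrow> real \<Rightarrow> real" where
  "hex_norm x y = max (max \<bar>x\<bar> \<bar>y\<bar>) \<bar>x + y\<bar>"

lemma hex_le_iff: "hex_norm x y \<le> c \<longleftrightarrow> \<bar>x\<bar> \<le> c \<and> \<bar>y\<bar> \<le> c \<and> \<bar>x + y\<bar> \<le> c"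
  by (auto simp: hex_norm_def)

lemma hex_minus: "hex_norm (- x) (- y) = hex_norm x y"
  by (simp only: hex_norm_def abs_minus_cancel minus_add_distrib[symmetric])

lemma hex_rotate: "hex_norm y (- (x + y)) = hex_norm x y"
proof -
  have "y + - (x + y) = - x" by simp
  then show ?thesis by (simp only: hex_norm_def abs_minus_cancel ac_simps)
qed

lemma hex_scale: "0 \<le> c \<Longrightarrow> hex_norm (c * x) (c * y) = c * hex_norm x y"
  by (simp add: hex_norm_def abs_mult max_mult_distrib_left flip: distrib_left)

lemma abs_convex_le:
  fixes t x y :: real
  assumes "0 \<le> t" "t \<le> 1" "\<bar>x\<bar> \<le> p" "\<bar>y\<bar> \<le> q"
  shows "\<bar>t * x + (1 - t) * y\<bar> \<le> t * p + (1 - t) * q"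
proof -
  have "\<bar>t * x + (1 - t) * y\<bar> \<le> \<bar>t * x\<bar> + \<bar>(1 - t) * y\<bar>"
    by (rule abs_triangle_ineq)
  also have "\<dots> = t * \<bar>x\<bar> + (1 - t) * \<bar>y\<bar>" using assms by (simp add: abs_mult)
  also have "\<dots> \<le> t * p + (1 - t) * q"
    using assms by (intro add_mono mult_left_mono) auto
  finally show ?thesis .
qed

text \<open>The case \<open>u = (a, - s, s - a)\<close>. The segment from \<open>(s - a, r)\<close> to \<open>(s - a, r) + u = (s, r - s)\<close>
  lies in the hexagon of radius \<open>r\<close>, and \<open>det u (s - a, r)\<close> is
  \<open>a r - s (a - s)\<close>. A convex combination with the segment from \<open>- u / 2\<close> to \<open>u / 2\<close>, which lies at
  height 0 and in the hexagon of radius \<open>a / 2\<close>, reaches the height of \<open>(y1, y2)\<close> without changing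
  the direction or the length of the segment.\<close>
lemma hex_chord_normalized:
  fixes a s r t y1 y2 :: real
  assumes "0 < a" "0 \<le> s" "s \<le> a" "a \<le> r" "0 \<le> t" "t \<le> 1"
    and det: "a * y2 + s * y1 = t * (a * r - s * (a - s))"
  shows "\<exists>k::int. hex_norm (y1 + k * a) (y2 - k * s) \<le> t * r + (1 - t) * (a / 2)"
proof -
  \<comment> \<open>\<open>(p1, p2)\<close> is the initial point of the combined segment; \<open>y = p + l u\<close> is moved into the segment
    by subtracting the integer part of \<open>l\<close>.\<close>
  define p1 where "p1 = t * (s - a) - (1 - t) * (a / 2)"
  define p2 where "p2 = t * r + (1 - t) * (s / 2)"
  define l where "l = (y1 - p1) / a"
  define \<theta> where "\<theta> = l - \<lfloor>l\<rfloor>"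
  have \<theta>: "0 \<le> \<theta>" "\<theta> \<le> 1" unfolding \<theta>_def by linarith+
  have y1: "y1 = p1 + l * a" using assms(1) by (simp add: l_def)
  have "a * p2 + s * p1 = t * (a * r - s * (a - s))"
    by (simp add: p1_def p2_def field_simps)
  then have "a * (y2 - (p2 - l * s)) = 0" using det y1 by (simp add: algebra_simps)
  then have y2: "y2 = p2 - l * s" using assms(1) by simp
  have q1: "y1 + of_int (- \<lfloor>l\<rfloor>) * a = p1 + \<theta> * a"
    and q2: "y2 - of_int (- \<lfloor>l\<rfloor>) * s = p2 - \<theta> * s"
    by (simp_all add: y1 y2 \<theta>_def algebra_simps)
  have \<theta>a: "0 \<le> \<theta> * a" "\<theta> * a \<le> a" and \<theta>s: "0 \<le> \<theta> * s" "\<theta> * s \<le> s"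
    using \<theta> assms(1,2) by (auto simp: mult_left_le_one_le)
  define e where "e = \<theta> * (a - s)"
  have \<theta>as: "0 \<le> e" "e \<le> a - s"
    using \<theta> assms(3) by (auto simp: e_def mult_left_le_one_le)
  have "p1 + \<theta> * a = t * (s - a + \<theta> * a) + (1 - t) * (\<theta> * a - a / 2)"
    by (simp add: p1_def algebra_simps)
  moreover have "\<bar>\<dots>\<bar> \<le> t * r + (1 - t) * (a / 2)"
    using \<theta>a assms by (intro abs_convex_le; linarith)
  moreover have "p2 - \<theta> * s = t * (r - \<theta> * s) + (1 - t) * (s / 2 - \<theta> * s)"
    by (simp add: p2_def algebra_simps)
  moreover have "\<bar>\<dots>\<bar> \<le> t * r + (1 - t) * (a / 2)"
    using \<theta>s assms by (intro abs_convex_le; linarith)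
  moreover have "p1 + \<theta> * a + (p2 - \<theta> * s) =
      t * (r - (a - s) + e) + (1 - t) * (e - (a - s) / 2)"
    by (simp add: p1_def p2_def e_def field_simps)
  moreover have "\<bar>\<dots>\<bar> \<le> t * r + (1 - t) * (a / 2)"
  proof (rule abs_convex_le)
    show "\<bar>r - (a - s) + e\<bar> \<le> r" using \<theta>as assms by (intro abs_leI) simp_all
    show "\<bar>e - (a - s) / 2\<bar> \<le> a / 2" using \<theta>as assms by (intro abs_leI) (simp_all add: field_simps)
  qed (use assms in auto)
  ultimately have "hex_norm (p1 + \<theta> * a) (p2 - \<theta> * s) \<le> t * r + (1 - t) * (a / 2)"
    by (simp add: hex_le_iff)
  then show ?thesis using q1 q2 by metis
qed

text \<open>By the symmetries of the hexagon \<open>u\<close> can be brought to the form of the previous lemma. There the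
  height of the chord is \<open>a r - s (a - s)\<close>, which is smallest for \<open>s = a / 2\<close>. The slack \<open>t\<close> in the
  determinant bound is kept because for \<open>r = a\<close> it yields a strictly smaller norm than \<open>a\<close>.\<close>
lemma hex_chord:
  fixes a r t x1 x2 y1 y2 :: real
  assumes "hex_norm x1 x2 = a" "0 < a" "a \<le> r" "0 \<le> t" "t \<le> 1"
    and "\<bar>x1 * y2 - x2 * y1\<bar> \<le> t * (a * r - a\<^sup>2 / 4)"
  shows "\<exists>k::int. hex_norm (y1 + k * x1) (y2 + k * x2) \<le> t * r + (1 - t) * (a / 2)"
proof -
  define B where "B = t * r + (1 - t) * (a / 2)"
  define good where "good = (\<lambda>x1 x2 y1 y2. \<exists>k::int. hex_norm (y1 + k * x1) (y2 + k * x2) \<le> B)"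
  have pos: "good a x2 y1 y2"
    if "- a \<le> x2" "x2 \<le> 0" "0 \<le> a * y2 - x2 * y1" "a * y2 - x2 * y1 \<le> t * (a * r - a\<^sup>2 / 4)"
    for x2 y1 y2
  proof -
    define D where "D = a * r - (- x2) * (a - (- x2))"
    define t' where "t' = (a * y2 - x2 * y1) / D"
    \<comment> \<open>\<open>s (a - s) \<le> a\<^sup>2 / 4\<close> for \<open>s = - x2\<close>, by the arithmetic-geometric mean inequality\<close>
    have "0 \<le> (a / 2 + x2)\<^sup>2" by simp
    then have Dge: "a * r - a\<^sup>2 / 4 \<le> D" by (simp add: D_def power2_eq_square algebra_simps)
    have "a\<^sup>2 \<le> a * r" using assms by (simp add: power2_eq_square mult_left_mono)
    moreover have "0 < a\<^sup>2" using assms by simp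
    ultimately have D0: "0 < D" using Dge by linarith
    have t'0: "0 \<le> t'" using that D0 by (simp add: t'_def)
    have "a * y2 - x2 * y1 \<le> t * D"
      using that(4) mult_left_mono[OF Dge assms(4)] by linarith
    then have t't: "t' \<le> t" using D0 by (simp add: t'_def divide_le_eq)
    have det: "a * y2 + (- x2) * y1 = t' * (a * r - (- x2) * (a - (- x2)))"
      using D0 unfolding t'_def D_def[symmetric] by simp
    have x2: "0 \<le> - x2" "- x2 \<le> a" and t'1: "t' \<le> 1" using that t't assms(5) by simp_all
    obtain k :: int where "hex_norm (y1 + k * a) (y2 - k * (- x2)) \<le> t' * r + (1 - t') * (a / 2)"
      using hex_chord_normalized[OF assms(2) x2 assms(3) t'0 t'1 det] by blast
    moreover have "t' * r + (1 - t') * (a / 2) \<le> B"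
    proof -
      have "t' * (r - a / 2) \<le> t * (r - a / 2)"
        using t't assms by (intro mult_right_mono) auto
      then show ?thesis by (simp add: B_def algebra_simps diff_divide_distrib)
    qed
    ultimately show ?thesis unfolding good_def by (intro exI[of _ k]) simp
  qed
  have neg_y: "good x1 x2 y1 y2" if "good x1 x2 (- y1) (- y2)" for x1 x2 y1 y2
  proof -
    from that obtain k :: int where "hex_norm (- y1 + k * x1) (- y2 + k * x2) \<le> B"
      unfolding good_def by blast
    then have "hex_norm (y1 + (- k) * x1) (y2 + (- k) * x2) \<le> B"
      using hex_minus[of "- y1 + k * x1" "- y2 + k * x2"] by simp
    then show ?thesis unfolding good_def by (metis of_int_minus)
  qed
  have neg_x: "good x1 x2 y1 y2" if "good (- x1) (- x2) y1 y2" for x1 x2 y1 y2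
  proof -
    from that obtain k :: int where "hex_norm (y1 + k * (- x1)) (y2 + k * (- x2)) \<le> B"
      unfolding good_def by blast
    then have "hex_norm (y1 + (- k) * x1) (y2 + (- k) * x2) \<le> B" by simp
    then show ?thesis unfolding good_def by (metis of_int_minus)
  qed
  have rot: "good x1 x2 y1 y2" if "good x2 (- (x1 + x2)) y2 (- (y1 + y2))" for x1 x2 y1 y2
  proof -
    from that obtain k :: int
      where "hex_norm (y2 + k * x2) (- (y1 + y2) + k * (- (x1 + x2))) \<le> B"
      unfolding good_def by blast
    moreover have "- (y1 + y2) + k * (- (x1 + x2)) = - ((y1 + k * x1) + (y2 + k * x2))"
      by (simp add: algebra_simps)
    ultimately show ?thesis unfolding good_def by (metis hex_rotate)
  qed
  have first: "good a x2 y1 y2" if "- a \<le> x2" "x2 \<le> 0" "\<bar>a * y2 - x2 * y1\<bar> \<le> t * (a * r - a\<^sup>2 / 4)"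
    for x2 y1 y2
  proof (cases "0 \<le> a * y2 - x2 * y1")
    case True
    then show ?thesis using pos[of x2 y2 y1] that by simp
  next
    case False
    then have "good a x2 (- y1) (- y2)" using pos[of x2 "- y2" "- y1"] that by simp
    then show ?thesis by (rule neg_y)
  qed
  have abs: "good x1 x2 y1 y2"
    if "hex_norm x1 x2 = a" "\<bar>x1\<bar> = a" "\<bar>x1 * y2 - x2 * y1\<bar> \<le> t * (a * r - a\<^sup>2 / 4)" for x1 x2 y1 y2
  proof (cases "x1 = a")
    case True
    then show ?thesis using first[of x2 y2 y1] that by (auto simp: hex_norm_def)
  next
    case False
    then have "x1 = - a" using that assms(2) by linarith
    then have "good (- x1) (- x2) y1 y2"
      using first[of "- x2" y2 y1] that by (auto simp: hex_norm_def)
    then show ?thesis by (rule neg_x)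
  qed
  \<comment> \<open>The rotation \<open>(x, y) \<mapsto> (y, - (x + y))\<close> and its square preserve determinants.\<close>
  have r1: "x2 * (- (y1 + y2)) - (- (x1 + x2)) * y2 = x1 * y2 - x2 * y1"
    and r2: "- (x1 + x2) * (- (y2 + - (y1 + y2))) - (- (x2 + - (x1 + x2))) * (- (y1 + y2)) =
      x1 * y2 - x2 * y1"
    by (simp_all add: algebra_simps)
  consider "\<bar>x1\<bar> = a" | "\<bar>x2\<bar> = a" | "\<bar>x1 + x2\<bar> = a"
    using assms(1) by (auto simp: hex_norm_def max_def split: if_splits)
  then have "good x1 x2 y1 y2"
  proof cases
    case 1
    then show ?thesis using abs assms by blast
  next
    case 2
    have "good x2 (- (x1 + x2)) y2 (- (y1 + y2))"
      by (rule abs) (simp_all only: hex_rotate r1 assms 2)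
    then show ?thesis by (rule rot)
  next
    case 3
    have "good (- (x1 + x2)) (- (x2 + - (x1 + x2))) (- (y1 + y2)) (- (y2 + - (y1 + y2)))"
      by (rule abs) (simp_all only: hex_rotate r2 assms 3 abs_minus_cancel)
    then show ?thesis by (rule rot[OF rot])
  qed
  then show ?thesis by (simp add: good_def B_def)
qed

section \<open>Short vectors of a planar integer lattice\<close>

lemma integer_lattice_iff_3:
  "z \<in> integer_lattice \<longleftrightarrow> z $ 1 \<in> \<int> \<and> z $ 2 \<in> \<int> \<and> z $ 3 \<in> \<int>" for z :: "real^3"
  by (simp add: integer_lattice_def forall_3)

lemma integer_lattice_add: "x \<in> integer_lattice \<Longrightarrow> y \<in> integer_lattice \<Longrightarrow> x + y \<in> integer_lattice"
  by (simp add: integer_lattice_def)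

lemma integer_lattice_scale: "x \<in> integer_lattice \<Longrightarrow> of_int k *\<^sub>R x \<in> integer_lattice"
  by (simp add: integer_lattice_def)

lemma integer_lattice_cross:
  "x \<in> integer_lattice \<Longrightarrow> y \<in> integer_lattice \<Longrightarrow> x \<times> y \<in> integer_lattice" for x y :: "real^3"
  by (simp add: integer_lattice_iff_3 cross3_def)

text \<open>Dividing an integer vector by the greatest common divisor of its coordinates cannot make it
  longer, and Bezout's identity then supplies the vector \<open>t\<close>.\<close>
lemma integer_vector_primitive_part:
  fixes u :: "real^3"
  assumes "u \<in> integer_lattice" "u \<noteq> 0"
  obtains g v t where "1 \<le> g" "u = g *\<^sub>R v" "v \<in> integer_lattice" "t \<in> integer_lattice" "t \<bullet> v = 1"
proof -
  from assms(1) obtain a b c :: int where abc: "u $ 1 = a" "u $ 2 = b" "u $ 3 = c"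
    unfolding integer_lattice_iff_3 by (elim conjE Ints_cases)
  define g where "g = gcd (gcd a b) c"
  have "g \<noteq> 0" using assms(2) abc by (auto simp: g_def vec_eq_iff forall_3)
  then have g1: "1 \<le> g" by (metis g_def gcd_ge_0_int int_one_le_iff_zero_less le_less)
  obtain p q where pq: "p * a + q * b = gcd a b" using bezout_int by blast
  obtain m n where mn: "m * gcd a b + n * c = g" using bezout_int g_def by blast
  obtain a' b' c' where abc': "a = g * a'" "b = g * b'" "c = g * c'"
    by (metis g_def dvdE dvd_trans gcd_dvd1 gcd_dvd2)
  have "m * (p * a + q * b) + n * c = g" using mn pq by simp
  then have "g * (m * p * a' + m * q * b' + n * c') = g * 1"
    unfolding abc' by (simp add: algebra_simps)
  then have one: "m * p * a' + m * q * b' + n * c' = 1" using \<open>g \<noteq> 0\<close> mult_cancel_left by blast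
  define v :: "real^3" where "v = vector [a', b', c']"
  define t :: "real^3" where "t = vector [m * p, m * q, n]"
  have "t \<bullet> v = of_int (m * p * a' + m * q * b' + n * c')"
    by (simp add: t_def v_def inner_vec_def sum_3)
  then have "t \<bullet> v = 1" by (simp only: one of_int_1)
  moreover have "u = of_int g *\<^sub>R v"
    by (simp add: vec_eq_iff forall_3 abc abc' v_def)
  ultimately show thesis
    using g1 by (intro that[of "of_int g" v t]) (simp_all add: v_def t_def integer_lattice_iff_3)
qed

text \<open>A second basis vector needs no reduction theory: if \<open>t \<bullet> u = 1\<close>, then \<open>v = w \<times> t\<close> is orthogonal
  to \<open>w\<close> and satisfies \<open>u \<times> v = (u \<bullet> t) w - (u \<bullet> w) t = w\<close>. Hence the determinant of \<open>u\<close> and \<open>v\<close> in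
  the coordinates \<open>F\<close> and \<open>G\<close> is \<open>(F \<times> G) \<bullet> w\<close>, and adding multiples of \<open>u\<close> to \<open>v\<close> preserves this.\<close>
lemma planar_lattice_short_vectors:
  fixes F G w :: "real^3"
  defines "L \<equiv> {z \<in> integer_lattice. w \<bullet> z = 0}"
  defines "N \<equiv> \<lambda>z. hex_norm (F \<bullet> z) (G \<bullet> z)"
  assumes w: "w \<in> integer_lattice" "w \<noteq> 0" and covol: "\<bar>w \<bullet> (F \<times> G)\<bar> \<le> 1"
    and fin: "\<And>c. finite {z \<in> L. N z \<le> c}"
    and no_short: "\<And>z. z \<in> L \<Longrightarrow> z \<noteq> 0 \<Longrightarrow> 1 < N z"
  shows "\<exists>u\<in>L. \<exists>p\<in>L. u \<times> p \<noteq> 0 \<and> N u \<le> 2 / sqrt 3 \<and> N p \<le> 5 / 4"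
proof -
  obtain e where e: "e \<in> L" "e \<noteq> 0"
  proof (cases "w $ 1 = 0 \<and> w $ 2 = 0")
    case True
    show thesis
      by (rule that[of "axis 1 1"])
        (use True in \<open>auto simp: L_def integer_lattice_iff_3 inner_axis\<close>,
          auto simp: axis_def)
  next
    case False
    show thesis
      by (rule that[of "vector [- w $ 2, w $ 1, 0]"])
        (use False w in \<open>auto simp: L_def integer_lattice_iff_3 inner_vec_def sum_3 vec_eq_iff forall_3\<close>)
  qed
  obtain u0 where u0: "u0 \<in> L" "u0 \<noteq> 0" and min0: "\<And>z. z \<in> L \<Longrightarrow> z \<noteq> 0 \<Longrightarrow> N u0 \<le> N z"
  proof -
    define S where "S = {z \<in> L. N z \<le> N e} - {0}"
    have "finite S" "S \<noteq> {}" using fin e by (auto simp: S_def)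
    then obtain u where u: "u \<in> S" "\<forall>z\<in>S. N u \<le> N z"
      using arg_min_if_finite[of S N] by (metis not_less)
    have "N u \<le> N z" if "z \<in> L" "z \<noteq> 0" for z
      using u that by (cases "N z \<le> N e") (auto simp: S_def)
    then show thesis using u(1) by (intro that[of u]) (auto simp: S_def)
  qed
  \<comment> \<open>The primitive part of a shortest vector is again a shortest vector.\<close>
  obtain g u t where g: "1 \<le> g" "u0 = g *\<^sub>R u" and ui: "u \<in> integer_lattice"
    and t: "t \<in> integer_lattice" "t \<bullet> u = 1"
    using integer_vector_primitive_part[of u0] u0 by (auto simp: L_def)
  have wu: "w \<bullet> u = 0" using u0 g by (auto simp: L_def)
  have u: "u \<in> L" "u \<noteq> 0" using ui wu t by (auto simp: L_def)
  define a where "a = N u"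
  have a1: "1 < a" using no_short u by (simp add: a_def)
  have "N u0 = g * a" using g hex_scale[of g "F \<bullet> u" "G \<bullet> u"] by (simp add: a_def N_def)
  then have "a \<le> N u0" using g a1 by simp
  then have min: "\<And>z. z \<in> L \<Longrightarrow> z \<noteq> 0 \<Longrightarrow> a \<le> N z" using min0 order_trans by blast
  define v where "v = w \<times> t"
  have uv: "u \<times> v = w"
    using wu t unfolding v_def Lagrange by (simp add: inner_commute)
  have vL: "v \<in> L" using w t by (simp add: v_def L_def integer_lattice_cross dot_cross_self)
  have det: "\<bar>(F \<bullet> u) * (G \<bullet> v) - (G \<bullet> u) * (F \<bullet> v)\<bar> \<le> 1"
  proof -
    have "(F \<times> G) \<bullet> (u \<times> v) = (F \<bullet> u) * (G \<bullet> v) - (G \<bullet> u) * (F \<bullet> v)"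
      by (simp add: dot_cross inner_commute)
    then show ?thesis using covol uv by (simp add: inner_commute)
  qed
  have reduce: "\<exists>p\<in>L. u \<times> p \<noteq> 0 \<and> N p \<le> s * r + (1 - s) * (a / 2)"
    if rs: "a \<le> r" "0 \<le> s" "s \<le> 1" "1 \<le> s * (a * r - a\<^sup>2 / 4)" for r s
  proof -
    obtain k :: int where k: "hex_norm (F \<bullet> v + k * (F \<bullet> u)) (G \<bullet> v + k * (G \<bullet> u)) \<le> s * r + (1 - s) * (a / 2)"
      using hex_chord[OF a_def[unfolded N_def, symmetric] _ rs(1-3), of "G \<bullet> v" "F \<bullet> v"]
        rs(4) a1 det by auto
    define p where "p = v + of_int k *\<^sub>R u"
    have "u \<times> p = w" by (simp add: p_def cross_add_right cross_mult_right uv)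
    moreover have "p \<in> L"
      using vL u by (simp add: p_def L_def integer_lattice_add integer_lattice_scale inner_right_distrib)
    ultimately show ?thesis using k w by (intro bexI[of _ p]) (simp_all add: N_def p_def inner_right_distrib)
  qed
  have sq: "(2 / sqrt 3)\<^sup>2 = (4 / 3 :: real)" by (simp add: power_divide)
  have first: "a \<le> 2 / sqrt 3"
  proof (rule ccontr)
    assume "\<not> ?thesis"
    then have "(2 / sqrt 3)\<^sup>2 < a\<^sup>2" by (intro power_strict_mono) auto
    then have a2: "4 / 3 < a\<^sup>2" by (simp only: sq)
    \<comment> \<open>For \<open>r = a\<close> the chord lies at height at least \<open>3 a\<^sup>2 / 4 > 1\<close>, so a proper convex combination
      suffices and the vector found is shorter than the shortest one.\<close>
    define s where "s = 4 / (3 * a\<^sup>2)"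
    have s: "0 \<le> s" "s < 1" using a2 by (simp_all add: s_def divide_less_eq)
    have "s * (a * a - a\<^sup>2 / 4) = 1"
      using a1 by (simp add: s_def power2_eq_square field_simps)
    then obtain p where p: "p \<in> L" "u \<times> p \<noteq> 0" "N p \<le> s * a + (1 - s) * (a / 2)"
      using reduce[of a s] s by auto
    have "s * a + (1 - s) * (a / 2) = a - (1 - s) * (a / 2)" by (simp add: field_simps)
    also have "\<dots> < a" using s a1 by simp
    finally have "N p < a" using p(3) by linarith
    moreover have "p \<noteq> 0" using p(2) by auto
    ultimately show False using min[of p] p(1) by linarith
  qed
  have "a \<le> 5 / 4"
  proof -
    have "8 / 5 \<le> sqrt 3" by (rule real_le_rsqrt) (simp add: power2_eq_square)
    then have "2 / sqrt 3 \<le> 2 / (8 / 5)" by (intro divide_left_mono) auto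
    then show ?thesis using first by simp
  qed
  then have "0 \<le> (a - 1) * (4 - a)" using a1 by (intro mult_nonneg_nonneg) simp_all
  then have "1 \<le> a * (5 / 4) - a\<^sup>2 / 4" by (simp add: power2_eq_square algebra_simps)
  then obtain p where "p \<in> L" "u \<times> p \<noteq> 0" "N p \<le> 5 / 4"
    using reduce[OF \<open>a \<le> 5 / 4\<close>, of 1] by auto
  then show ?thesis using u first a_def by blast
qed

section \<open>Successive minima of a parallelepiped\<close>

lemma row_eq_nth: "row i A = A $ i"
  by (simp add: row_def vec_eq_iff)

lemma independent_pair_iff_cross:
  "independent {x, y} \<and> x \<noteq> y \<longleftrightarrow> x \<times> y \<noteq> 0" for x y :: "real^3"
proof (cases "x = 0 \<or> y = 0 \<or> x = y")
  case True
  then show ?thesis using dependent_zero[of "{x, y}"] by auto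
next
  case False
  then have "independent {x, y} \<longleftrightarrow> y \<notin> span {x}"
    using independent_insert[of y "{x}"] by (auto simp: insert_commute)
  then show ?thesis using False
    by (auto simp: cross_eq_0 collinear_lemma span_singleton)
qed

text \<open>The forms determine the coordinates linearly, by expansion in the dual basis, so bounds on the
  forms bound the coordinates.\<close>
lemma finite_integer_lattice_form_box:
  fixes B :: "real^'n^'n"
  assumes "det B \<noteq> 0"
  shows "finite (integer_lattice \<inter> form_box B (\<lambda>_. c))"
proof -
  obtain G where G: "dual_forms B G" using dual_forms_exists[OF assms] by blast
  define M where "M = (\<Sum>j\<in>UNIV. \<Sum>i\<in>UNIV. \<bar>c\<bar> * \<bar>row i G $ j\<bar>)"
  define K where "K = {k :: real. k \<in> \<int> \<and> \<bar>k\<bar> \<le> M}"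
  have "finite K" unfolding K_def by (rule finite_abs_int_segment)
  then have "finite (vec_lambda ` (UNIV \<rightarrow>\<^sub>E K) :: (real^'n) set)"
    by (intro finite_imageI finite_PiE) auto
  moreover have "integer_lattice \<inter> form_box B (\<lambda>_. c) \<subseteq> vec_lambda ` (UNIV \<rightarrow>\<^sub>E K)"
  proof
    fix z assume z: "z \<in> integer_lattice \<inter> form_box B (\<lambda>_. c)"
    have "z $ j \<in> K" for j
    proof -
      have "\<bar>z $ j\<bar> = \<bar>\<Sum>i\<in>UNIV. (row i B \<bullet> z) * row i G $ j\<bar>"
        by (subst dual_forms_expansion[OF G, of z]) simp
      also have "\<dots> \<le> (\<Sum>i\<in>UNIV. \<bar>(row i B \<bullet> z) * row i G $ j\<bar>)" by (rule sum_abs)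
      also have "\<dots> \<le> (\<Sum>i\<in>UNIV. \<bar>c\<bar> * \<bar>row i G $ j\<bar>)"
      proof (rule sum_mono)
        fix i
        have "\<bar>row i B \<bullet> z\<bar> \<le> \<bar>c\<bar>" using z by (auto simp: form_box_def intro: order_trans[OF _ abs_ge_self])
        then show "\<bar>(row i B \<bullet> z) * row i G $ j\<bar> \<le> \<bar>c\<bar> * \<bar>row i G $ j\<bar>"
          by (simp add: abs_mult mult_right_mono)
      qed
      also have "\<dots> \<le> M"
        unfolding M_def by (rule member_le_sum) (auto intro: sum_nonneg)
      finally show ?thesis using z by (simp add: K_def integer_lattice_def)
    qed
    then have "vec_nth z \<in> UNIV \<rightarrow>\<^sub>E K" by auto
    then show "z \<in> vec_lambda ` (UNIV \<rightarrow>\<^sub>E K)" by (metis image_eqI vec_nth_inverse)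
  qed
  ultimately show ?thesis by (rule rev_finite_subset)
qed

text \<open>Absorbing the bounds \<open>\<eta>\<close> into the forms, at the price of an arbitrary nonzero determinant, makes
  the dilates \<open>\<mu> P\<close> simply the boxes with constant bound \<open>\<mu>\<close>.\<close>
lemma symmetric_parallelepiped_iff_unit_box:
  fixes P :: "(real^'n) set"
  shows "symmetric_parallelepiped P \<longleftrightarrow> (\<exists>B::real^'n^'n. det B \<noteq> 0 \<and> P = form_box B (\<lambda>_. 1))"
proof
  assume "symmetric_parallelepiped P"
  then obtain A B :: "real^'n^'n" where AB: "A ** B = mat 1" "B ** A = mat 1"
    and P: "P = {A *v t |t. \<forall>i. \<bar>t $ i\<bar> \<le> 1}"
    unfolding symmetric_parallelepiped_def invertible_def by blast
  have "det B \<noteq> 0" using AB by (metis invertible_def invertible_det_nz)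
  then show "\<exists>B::real^'n^'n. det B \<noteq> 0 \<and> P = form_box B (\<lambda>_. 1)"
    using P parallelepiped_as_form_box[OF AB(1)] by auto
next
  assume "\<exists>B::real^'n^'n. det B \<noteq> 0 \<and> P = form_box B (\<lambda>_. 1)"
  then obtain A B :: "real^'n^'n" where "A ** B = mat 1" "B ** A = mat 1" "P = form_box B (\<lambda>_. 1)"
    unfolding invertible_det_nz[symmetric] invertible_def by blast
  then show "symmetric_parallelepiped P"
    unfolding symmetric_parallelepiped_def invertible_def
    using parallelepiped_as_form_box[of A B] by blast
qed

lemma scaled_unit_box:
  assumes "0 < \<mu>"
  shows "(\<lambda>x. \<mu> *\<^sub>R x) ` form_box B (\<lambda>_. 1) = form_box B (\<lambda>_. \<mu>)"
proof
  show "(\<lambda>x. \<mu> *\<^sub>R x) ` form_box B (\<lambda>_. 1) \<subseteq> form_box B (\<lambda>_. \<mu>)"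
    using assms by (auto simp: form_box_def abs_mult)
  show "form_box B (\<lambda>_. \<mu>) \<subseteq> (\<lambda>x. \<mu> *\<^sub>R x) ` form_box B (\<lambda>_. 1)"
  proof
    fix z assume "z \<in> form_box B (\<lambda>_. \<mu>)"
    then have "(1 / \<mu>) *\<^sub>R z \<in> form_box B (\<lambda>_. 1)"
      using assms by (auto simp: form_box_def abs_mult)
    then show "z \<in> (\<lambda>x. \<mu> *\<^sub>R x) ` form_box B (\<lambda>_. 1)"
      using assms by (intro image_eqI[of _ _ "(1 / \<mu>) *\<^sub>R z"]) simp_all
  qed
qed

lemma successive_minimum_unit_box:
  "successive_minimum k (form_box B (\<lambda>_. 1)) L =
     Inf {\<mu>. 0 < \<mu> \<and> (\<exists>S. S \<subseteq> form_box B (\<lambda>_. \<mu>) \<inter> L \<and> independent S \<and> card S = k)}"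
  unfolding successive_minimum_def
  by (simp only: scaled_unit_box cong: conj_cong)

lemma successive_minimum_le:
  assumes "0 < \<mu>" "S \<subseteq> form_box B (\<lambda>_. \<mu>) \<inter> L" "independent S" "card S = k"
  shows "successive_minimum k (form_box B (\<lambda>_. 1)) L \<le> \<mu>"
  unfolding successive_minimum_unit_box
proof (rule cInf_lower)
  show "bdd_below {\<mu>. 0 < \<mu> \<and> (\<exists>S. S \<subseteq> form_box B (\<lambda>_. \<mu>) \<inter> L \<and> independent S \<and> card S = k)}"
    by (rule bdd_belowI[of _ 0]) auto
qed (intro CollectI conjI exI[of _ S]; fact assms)

text \<open>The set \<open>S0\<close> is contained in some dilate. It only serves to make the set of admissible factors
  nonempty, since the infimum of the empty set of reals is an unspecified number.\<close>
lemma successive_minimum_ge: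
  assumes "S0 \<subseteq> L" "independent S0" "card S0 = k"
    and lower: "\<And>\<mu> S. 0 < \<mu> \<Longrightarrow> S \<subseteq> form_box B (\<lambda>_. \<mu>) \<inter> L \<Longrightarrow> independent S \<Longrightarrow> card S = k \<Longrightarrow> c \<le> \<mu>"
  shows "c \<le> successive_minimum k (form_box B (\<lambda>_. 1)) L"
  unfolding successive_minimum_unit_box
proof (rule cInf_greatest)
  define \<mu> where "\<mu> = 1 + (\<Sum>z\<in>S0. \<Sum>i\<in>UNIV. \<bar>row i B \<bullet> z\<bar>)"
  have fin: "finite S0" using assms(2) by (rule finiteI_independent)
  have "0 < \<mu>" unfolding \<mu>_def by (intro add_pos_nonneg sum_nonneg) auto
  moreover have "S0 \<subseteq> form_box B (\<lambda>_. \<mu>)"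
  proof (clarsimp simp: form_box_def)
    fix z i assume "z \<in> S0"
    have "\<bar>row i B \<bullet> z\<bar> \<le> (\<Sum>i\<in>UNIV. \<bar>row i B \<bullet> z\<bar>)" by (rule member_le_sum) auto
    also have "\<dots> \<le> (\<Sum>z\<in>S0. \<Sum>i\<in>UNIV. \<bar>row i B \<bullet> z\<bar>)"
      by (rule member_le_sum) (use \<open>z \<in> S0\<close> fin in \<open>auto intro: sum_nonneg\<close>)
    finally show "\<bar>row i B \<bullet> z\<bar> \<le> \<mu>" by (simp add: \<mu>_def)
  qed
  ultimately have "\<mu> \<in> {\<mu>. 0 < \<mu> \<and> (\<exists>S. S \<subseteq> form_box B (\<lambda>_. \<mu>) \<inter> L \<and> independent S \<and> card S = k)}"
    using assms(1-3) by (intro CollectI conjI exI[of _ S0]) simp_all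
  then show "{\<mu>. 0 < \<mu> \<and> (\<exists>S. S \<subseteq> form_box B (\<lambda>_. \<mu>) \<inter> L \<and> independent S \<and> card S = k)} \<noteq> {}"
    by (rule ex_in_conv[THEN iffD1, OF exI])
qed (use lower in blast)

lemma axis_in_integer_lattice: "axis i 1 \<in> integer_lattice"
  by (simp add: integer_lattice_def axis_def)

text \<open>If no nonzero integer point lay in the box, then the finitely many ones in the doubled box would
  have gauge values bounded away from 1, and so would all the others.\<close>
lemma first_minimum_attained:
  fixes B :: "real^'n^'n"
  assumes "det B \<noteq> 0" "successive_minimum 1 (form_box B (\<lambda>_. 1)) integer_lattice \<le> 1"
  shows "\<exists>z. z \<in> integer_lattice \<and> z \<noteq> 0 \<and> z \<in> form_box B (\<lambda>_. 1)"
proof (rule ccontr)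
  assume none: "\<not> ?thesis"
  define T where "T = integer_lattice \<inter> form_box B (\<lambda>_. 2) - {0}"
  define N where "N = (\<lambda>z. Max (range (\<lambda>i. \<bar>row i B \<bullet> z\<bar>)))"
  have N_le: "N z \<le> \<mu> \<longleftrightarrow> z \<in> form_box B (\<lambda>_. \<mu>)" for z \<mu>
    by (auto simp: N_def form_box_def)
  define c where "c = Min (insert 2 (N ` T))"
  have T: "finite T" unfolding T_def using finite_integer_lattice_form_box[OF assms(1)] by blast
  have "1 < N z" if "z \<in> T" for z using none that N_le[of z 1] by (force simp: T_def)
  then have c1: "1 < c" unfolding c_def using T by (subst Min_gr_iff) auto
  have "c \<le> successive_minimum 1 (form_box B (\<lambda>_. 1)) integer_lattice"
  proof (rule successive_minimum_ge)
    show "{axis undefined 1 :: real^'n} \<subseteq> integer_lattice" by (simp add: axis_in_integer_lattice)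
    show "independent {axis undefined 1 :: real^'n}" by (simp add: axis_eq_0_iff)
    fix \<mu> and S :: "(real^'n) set"
    assume S: "S \<subseteq> form_box B (\<lambda>_. \<mu>) \<inter> integer_lattice" "independent S" "card S = 1"
    then obtain z where Sz: "S = {z}" by (metis card_1_singletonE)
    with S have z: "z \<in> form_box B (\<lambda>_. \<mu>)" "z \<in> integer_lattice" "z \<noteq> 0" by auto
    show "c \<le> \<mu>"
    proof (cases "\<mu> \<le> 2")
      case True
      then have "form_box B (\<lambda>_. \<mu>) \<subseteq> form_box B (\<lambda>_. 2)"
        by (auto simp: form_box_def intro: order_trans[of _ \<mu>])
      then have "z \<in> T" using z by (auto simp: T_def)
      then have "c \<le> N z" unfolding c_def using T by (intro Min_le) auto
      then show ?thesis using z(1) N_le[of z \<mu>] by linarith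
    next
      case False
      have "c \<le> 2" unfolding c_def using T by (intro Min_le) auto
      then show ?thesis using False by linarith
    qed
  qed simp
  then show False using c1 assms(2) by linarith
qed

section \<open>The pseudo-compound as the box of minors\<close>

definition minor_rows :: "real^3^3 \<Rightarrow> real^3^3" where
  "minor_rows B = vector [B $ 2 \<times> B $ 3, B $ 3 \<times> B $ 1, B $ 1 \<times> B $ 2]"

lemma det_eq_triple: "det B = B $ 1 \<bullet> (B $ 2 \<times> B $ 3)" for B :: "real^3^3"
  by (simp add: cross3_simps)

text \<open>This is the identity \<open>(b\<^sub>2 \<times> b\<^sub>3) \<bullet> ((b\<^sub>3 \<times> b\<^sub>1) \<times> (b\<^sub>1 \<times> b\<^sub>2)) = (b\<^sub>1 \<bullet> (b\<^sub>2 \<times> b\<^sub>3))\<^sup>2\<close>. It shows that the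
  pseudo-compound is again a nondegenerate box, so its first minimum is attained.\<close>
lemma det_minor_rows: "det (minor_rows B) = (det B)\<^sup>2"
proof -
  have "(B $ 3 \<times> B $ 1) \<times> (B $ 1 \<times> B $ 2) = (B $ 3 \<bullet> (B $ 1 \<times> B $ 2)) *\<^sub>R B $ 1"
    by (simp add: cross_cross_det dot_cross_det[symmetric])
  moreover have "B $ 3 \<bullet> (B $ 1 \<times> B $ 2) = det B" "(B $ 2 \<times> B $ 3) \<bullet> B $ 1 = det B"
    by (simp_all add: cross3_simps)
  ultimately show ?thesis
    unfolding det_eq_triple[of "minor_rows B"] by (simp add: minor_rows_def power2_eq_square)
qed

text \<open>Dividing the first form by \<open>D = det B\<close> normalizes the determinant; its bound becomes
  \<open>1 / \<bar>D\<bar>\<close>. The dual forms of the normalized system are the cross products of its rows, and the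
  factors \<open>D\<close> cancel against \<open>\<Prod>\<eta> = 1 / \<bar>D\<bar>\<close>.\<close>
lemma pseudo_compound_unit_box:
  fixes B :: "real^3^3"
  assumes "det B \<noteq> 0"
  shows "pseudo_compound (form_box B (\<lambda>_. 1)) = form_box (minor_rows B) (\<lambda>_. 1)"
proof -
  define D where "D = det B"
  have D: "D \<noteq> 0" "D = B $ 1 \<bullet> (B $ 2 \<times> B $ 3)" using assms by (simp_all add: D_def det_eq_triple)
  have D': "B $ 2 \<bullet> (B $ 3 \<times> B $ 1) = D" "B $ 3 \<bullet> (B $ 1 \<times> B $ 2) = D"
    unfolding D(2) by (simp_all add: cross3_simps)
  define H :: "real^3^3" where "H = vector [(1 / D) *\<^sub>R B $ 1, B $ 2, B $ 3]"
  define G :: "real^3^3" where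
    "G = vector [B $ 2 \<times> B $ 3, (1 / D) *\<^sub>R (B $ 3 \<times> B $ 1), (1 / D) *\<^sub>R (B $ 1 \<times> B $ 2)]"
  define \<eta> :: "3 \<Rightarrow> real" where "\<eta> = (\<lambda>i. if i = 1 then 1 / \<bar>D\<bar> else 1)"
  have \<eta>3: "\<eta> 1 = 1 / \<bar>D\<bar>" "\<eta> 2 = 1" "\<eta> 3 = 1" by (simp_all add: \<eta>_def)
  have prod: "prod \<eta> UNIV = 1 / \<bar>D\<bar>" by (simp add: \<eta>_def)
  have "det H = 1" unfolding det_eq_triple using D by (simp add: H_def)
  moreover have "dual_forms H G"
    unfolding dual_forms_def forall_3 row_eq_nth
    using D D' by (simp add: H_def G_def dot_cross_self)
  moreover have "\<And>i. 0 < \<eta> i" using D by (simp add: \<eta>_def)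
  ultimately have "pseudo_compound (form_box H \<eta>) = form_box G (\<lambda>i. 1 / \<eta> i * (\<Prod>j\<in>UNIV. \<eta> j))"
    by (rule pseudo_compound_form_box)
  moreover have "form_box H \<eta> = form_box B (\<lambda>_. 1)"
    unfolding form_box_def forall_3 row_eq_nth \<eta>3 using D(1)
    by (simp add: H_def abs_mult divide_right_mono_neg divide_le_cancel)
  moreover have "form_box G (\<lambda>i. 1 / \<eta> i * (\<Prod>j\<in>UNIV. \<eta> j)) = form_box (minor_rows B) (\<lambda>_. 1)"
    unfolding form_box_def forall_3 row_eq_nth prod \<eta>3 using D(1)
    by (simp add: G_def minor_rows_def abs_mult divide_le_cancel)
  ultimately show ?thesis by simp
qed

section \<open>Upper bounds for the two minima\<close>

text \<open>Among all sections \<open>\<bar>x\<bar>, \<bar>y\<bar>, \<bar>p x + q y\<bar> \<le> 1\<close> with \<open>0 \<le> p, q \<le> 1\<close>, the hexagon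
  \<open>p = q = 1\<close> is the smallest.\<close>
lemma abs_combination_le_hex:
  assumes "\<bar>p\<bar> \<le> 1" "\<bar>q\<bar> \<le> 1" "0 \<le> p" "0 \<le> q"
  shows "\<bar>p * x + q * y\<bar> \<le> hex_norm x y"
proof -
  have b: "min 0 x \<le> c * x \<and> c * x \<le> max 0 x" if "0 \<le> c" "c \<le> 1" for c x :: real
  proof (cases "0 \<le> x")
    case True
    then show ?thesis using that by (simp add: mult_left_le_one_le)
  next
    case False
    then show ?thesis using that mult_right_mono_neg[of c 1 x]
      by (simp add: mult_nonneg_nonpos)
  qed
  have "min 0 x \<le> p * x" "p * x \<le> max 0 x" "min 0 y \<le> q * y" "q * y \<le> max 0 y"
    using b[of p x] b[of q y] assms by auto
  moreover have "\<bar>x\<bar> \<le> hex_norm x y" "\<bar>y\<bar> \<le> hex_norm x y" "\<bar>x + y\<bar> \<le> hex_norm x y"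
    by (simp_all add: hex_norm_def)
  ultimately show ?thesis
    by (intro abs_leI; cases "0 \<le> x"; cases "0 \<le> y"; simp; linarith)
qed


text \<open>On the plane \<open>w \<bullet> z = 0\<close> the three forms satisfy one linear relation, whose coefficients are the
  minors; the form belonging to the largest minor is \<open>h\<close>. The signs of \<open>f\<close> and \<open>g\<close> are changed so
  that \<open>h\<close> becomes a combination with coefficients in \<open>[0, 1]\<close>.\<close>
lemma parallelepiped_short_lattice_vectors:
  fixes f g h w :: "real^3"
  defines "box_points \<equiv> \<lambda>c. {z \<in> integer_lattice. \<bar>f \<bullet> z\<bar> \<le> c \<and> \<bar>g \<bullet> z\<bar> \<le> c \<and> \<bar>h \<bullet> z\<bar> \<le> c}"
  assumes w: "w \<in> integer_lattice" "w \<noteq> 0"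
    and indep: "f \<bullet> (g \<times> h) \<noteq> 0"
    and minors: "\<bar>w \<bullet> (f \<times> g)\<bar> \<le> 1" "\<bar>w \<bullet> (g \<times> h)\<bar> \<le> \<bar>w \<bullet> (f \<times> g)\<bar>"
      "\<bar>w \<bullet> (h \<times> f)\<bar> \<le> \<bar>w \<bullet> (f \<times> g)\<bar>"
    and fin: "\<And>c. finite (box_points c)" and no_short: "box_points 1 \<subseteq> {0}"
  shows "\<exists>u\<in>box_points (2 / sqrt 3). \<exists>p\<in>box_points (5 / 4). u \<times> p \<noteq> 0"
proof -
  define c1 c2 c3 where "c1 = w \<bullet> (g \<times> h)" and "c2 = w \<bullet> (h \<times> f)" and "c3 = w \<bullet> (f \<times> g)"
  have expand: "(f \<bullet> (g \<times> h)) * (w \<bullet> z) = c1 * (f \<bullet> z) + c2 * (g \<bullet> z) + c3 * (h \<bullet> z)" for z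
    unfolding c1_def c2_def c3_def by (simp add: cross3_simps)
  have c3: "c3 \<noteq> 0"
  proof
    assume "c3 = 0"
    then have "c1 = 0" "c2 = 0" using minors by (simp_all add: c1_def c2_def c3_def)
    then show False using expand[of w] \<open>c3 = 0\<close> indep w by simp
  qed
  \<comment> \<open>The coefficients of \<open>f\<close> and \<open>g\<close> in the relation solved for \<open>h\<close>\<close>
  define p q where "p = - c1 / c3" and "q = - c2 / c3"
  have pq: "\<bar>p\<bar> \<le> 1" "\<bar>q\<bar> \<le> 1"
    using minors c3 by (simp_all add: p_def q_def c1_def c2_def c3_def)
  define F G where "F = (if 0 \<le> p then f else - f)" and "G = (if 0 \<le> q then g else - g)"
  define N where "N = (\<lambda>z. hex_norm (F \<bullet> z) (G \<bullet> z))"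
  define L where "L = {z \<in> integer_lattice. w \<bullet> z = 0}"
  have F: "\<bar>F \<bullet> z\<bar> = \<bar>f \<bullet> z\<bar>" "p * (f \<bullet> z) = \<bar>p\<bar> * (F \<bullet> z)" for z by (simp_all add: F_def)
  have G: "\<bar>G \<bullet> z\<bar> = \<bar>g \<bullet> z\<bar>" "q * (g \<bullet> z) = \<bar>q\<bar> * (G \<bullet> z)" for z by (simp_all add: G_def)
  have in_box_points: "z \<in> box_points c" if "z \<in> L" "N z \<le> c" for z c
  proof -
    have "0 = c1 * (f \<bullet> z) + c2 * (g \<bullet> z) + c3 * (h \<bullet> z)"
      using expand[of z] that by (simp add: L_def)
    then have "h \<bullet> z = p * (f \<bullet> z) + q * (g \<bullet> z)"
      using c3 by (simp add: p_def q_def field_simps)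
    then have "h \<bullet> z = \<bar>p\<bar> * (F \<bullet> z) + \<bar>q\<bar> * (G \<bullet> z)" by (simp only: F G)
    then have "\<bar>h \<bullet> z\<bar> \<le> N z"
      unfolding N_def using abs_combination_le_hex[of "\<bar>p\<bar>" "\<bar>q\<bar>"] pq by simp
    moreover have "\<bar>f \<bullet> z\<bar> \<le> N z" "\<bar>g \<bullet> z\<bar> \<le> N z"
      unfolding N_def F(1)[symmetric] G(1)[symmetric] by (simp_all add: hex_norm_def)
    ultimately show ?thesis using that by (simp add: box_points_def L_def)
  qed
  have "\<exists>u\<in>{z \<in> integer_lattice. w \<bullet> z = 0}. \<exists>p\<in>{z \<in> integer_lattice. w \<bullet> z = 0}.
      u \<times> p \<noteq> 0 \<and> hex_norm (F \<bullet> u) (G \<bullet> u) \<le> 2 / sqrt 3 \<and> hex_norm (F \<bullet> p) (G \<bullet> p) \<le> 5 / 4"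
  proof (rule planar_lattice_short_vectors[OF w])
    show "\<bar>w \<bullet> (F \<times> G)\<bar> \<le> 1" using minors(1) by (simp add: F_def G_def)
    fix c
    have "{z \<in> L. N z \<le> c} \<subseteq> box_points c" using in_box_points by blast
    then show "finite {z \<in> {z \<in> integer_lattice. w \<bullet> z = 0}. hex_norm (F \<bullet> z) (G \<bullet> z) \<le> c}"
      using fin finite_subset unfolding L_def N_def by blast
  next
    fix z :: "real^3" assume "z \<in> {z \<in> integer_lattice. w \<bullet> z = 0}" "z \<noteq> 0"
    then show "1 < hex_norm (F \<bullet> z) (G \<bullet> z)"
      using in_box_points[of z 1] no_short unfolding L_def N_def by force
  qed
  then show ?thesis using in_box_points unfolding L_def N_def by blast
qed

text \<open>A cyclic renumbering of the forms brings the largest minor to the last place.\<close>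
lemma successive_minima_upper_bounds:
  fixes P :: "(real^3) set"
  assumes "symmetric_parallelepiped P"
    and compound: "successive_minimum 1 (pseudo_compound P) integer_lattice \<le> 1"
    and first: "1 < successive_minimum 1 P integer_lattice"
  shows "successive_minimum 1 P integer_lattice \<le> 2 / sqrt 3"
    and "successive_minimum 2 P integer_lattice \<le> 5 / 4"
proof -
  obtain B :: "real^3^3" where B: "det B \<noteq> 0" and P: "P = form_box B (\<lambda>_. 1)"
    using assms(1) symmetric_parallelepiped_iff_unit_box by blast
  define C where "C = minor_rows B"
  have "det C \<noteq> 0" using B by (simp add: C_def det_minor_rows)
  moreover have "successive_minimum 1 (form_box C (\<lambda>_. 1)) integer_lattice \<le> 1"
    using compound by (simp add: P C_def pseudo_compound_unit_box[OF B])
  ultimately obtain w where w: "w \<in> integer_lattice" "w \<noteq> 0" "w \<in> form_box C (\<lambda>_. 1)"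
    using first_minimum_attained by blast
  have minors: "\<bar>w \<bullet> (B $ 2 \<times> B $ 3)\<bar> \<le> 1" "\<bar>w \<bullet> (B $ 3 \<times> B $ 1)\<bar> \<le> 1" "\<bar>w \<bullet> (B $ 1 \<times> B $ 2)\<bar> \<le> 1"
    using w(3) by (simp_all add: form_box_def forall_3 row_eq_nth C_def minor_rows_def inner_commute)
  define box_points where "box_points = (\<lambda>c. integer_lattice \<inter> form_box B (\<lambda>_. c))"
  have box_points_3: "box_points c = {z \<in> integer_lattice. \<bar>B $ 1 \<bullet> z\<bar> \<le> c \<and> \<bar>B $ 2 \<bullet> z\<bar> \<le> c \<and> \<bar>B $ 3 \<bullet> z\<bar> \<le> c}" for c
    by (auto simp: box_points_def form_box_def forall_3 row_eq_nth)
  have fin: "finite (box_points c)" for c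
    unfolding box_points_def by (rule finite_integer_lattice_form_box[OF B])
  have no_short: "box_points 1 \<subseteq> {0}"
  proof
    fix z assume z: "z \<in> box_points 1"
    show "z \<in> {0}"
    proof (rule ccontr)
      assume "z \<notin> {0}"
      then have "successive_minimum 1 P integer_lattice \<le> 1"
        unfolding P using z by (intro successive_minimum_le[where S = "{z}"]) (auto simp: box_points_def)
      then show False using first by linarith
    qed
  qed
  have perm: "{z \<in> integer_lattice. \<bar>B $ 2 \<bullet> z\<bar> \<le> c \<and> \<bar>B $ 3 \<bullet> z\<bar> \<le> c \<and> \<bar>B $ 1 \<bullet> z\<bar> \<le> c} = box_points c"
    "{z \<in> integer_lattice. \<bar>B $ 3 \<bullet> z\<bar> \<le> c \<and> \<bar>B $ 1 \<bullet> z\<bar> \<le> c \<and> \<bar>B $ 2 \<bullet> z\<bar> \<le> c} = box_points c" for c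
    unfolding box_points_3 by auto
  have triple: "B $ 1 \<bullet> (B $ 2 \<times> B $ 3) \<noteq> 0" "B $ 2 \<bullet> (B $ 3 \<times> B $ 1) \<noteq> 0" "B $ 3 \<bullet> (B $ 1 \<times> B $ 2) \<noteq> 0"
  proof -
    have "B $ 2 \<bullet> (B $ 3 \<times> B $ 1) = det B" "B $ 3 \<bullet> (B $ 1 \<times> B $ 2) = det B"
      by (simp_all add: cross3_simps)
    then show "B $ 1 \<bullet> (B $ 2 \<times> B $ 3) \<noteq> 0" "B $ 2 \<bullet> (B $ 3 \<times> B $ 1) \<noteq> 0" "B $ 3 \<bullet> (B $ 1 \<times> B $ 2) \<noteq> 0"
      using B by (simp_all add: det_eq_triple)
  qed
  note core = parallelepiped_short_lattice_vectors[OF w(1,2)]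
  consider
      "\<bar>w \<bullet> (B $ 2 \<times> B $ 3)\<bar> \<le> \<bar>w \<bullet> (B $ 1 \<times> B $ 2)\<bar>" "\<bar>w \<bullet> (B $ 3 \<times> B $ 1)\<bar> \<le> \<bar>w \<bullet> (B $ 1 \<times> B $ 2)\<bar>"
    | "\<bar>w \<bullet> (B $ 3 \<times> B $ 1)\<bar> \<le> \<bar>w \<bullet> (B $ 2 \<times> B $ 3)\<bar>" "\<bar>w \<bullet> (B $ 1 \<times> B $ 2)\<bar> \<le> \<bar>w \<bullet> (B $ 2 \<times> B $ 3)\<bar>"
    | "\<bar>w \<bullet> (B $ 1 \<times> B $ 2)\<bar> \<le> \<bar>w \<bullet> (B $ 3 \<times> B $ 1)\<bar>" "\<bar>w \<bullet> (B $ 2 \<times> B $ 3)\<bar> \<le> \<bar>w \<bullet> (B $ 3 \<times> B $ 1)\<bar>"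
    by linarith
  then have "\<exists>u\<in>box_points (2 / sqrt 3). \<exists>p\<in>box_points (5 / 4). u \<times> p \<noteq> 0"
  proof cases
    case 1
    then show ?thesis
      by (rule core[OF triple(1) minors(3), folded box_points_3, OF _ _ fin no_short])
  next
    case 2
    then show ?thesis
      by (rule core[OF triple(2) minors(1), unfolded perm, OF _ _ fin no_short])
  next
    case 3
    then show ?thesis
      by (rule core[OF triple(3) minors(2), unfolded perm, OF _ _ fin no_short])
  qed
  then obtain u p where u: "u \<in> box_points (2 / sqrt 3)" and p: "p \<in> box_points (5 / 4)" and up: "u \<times> p \<noteq> 0"
    by blast
  show "successive_minimum 1 P integer_lattice \<le> 2 / sqrt 3"
    unfolding P using u up by (intro successive_minimum_le[where S = "{u}"]) (auto simp: box_points_def)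
  have "8 / 5 \<le> sqrt 3" by (rule real_le_rsqrt) (simp add: power2_eq_square)
  then have "2 / sqrt 3 \<le> 2 / (8 / 5)" by (intro divide_left_mono) auto
  then have le: "2 / sqrt 3 \<le> 5 / 4" by simp
  have "\<bar>row i B \<bullet> u\<bar> \<le> 2 / sqrt 3" for i using u by (simp add: box_points_def form_box_def)
  then have "\<bar>row i B \<bullet> u\<bar> \<le> 5 / 4" for i using le by (rule order_trans)
  then have "{u, p} \<subseteq> form_box B (\<lambda>_. 5 / 4) \<inter> integer_lattice"
    using u p by (simp add: box_points_def form_box_def)
  moreover have "independent {u, p}" "card {u, p} = 2"
    using up independent_pair_iff_cross[of u p] by auto
  ultimately show "successive_minimum 2 P integer_lattice \<le> 5 / 4"
    unfolding P by (intro successive_minimum_le) simp_all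
qed

section \<open>The extremal parallelepipeds\<close>

text \<open>The columns are the lattice basis in the coordinates given by the forms. The first two span a
  lattice in the plane \<open>x + y + z = 0\<close>; any sufficiently large multiple of \<open>(1, 1, 1)\<close> would do for the
  third.\<close>
definition extremal_forms :: "real \<Rightarrow> real \<Rightarrow> real^3^3" where
  "extremal_forms a r =
     vector [vector [a, - a / 2, 2], vector [- a / 2, r, 2], vector [- a / 2, a / 2 - r, 2]]"

text \<open>Points off the plane \<open>x + y + z = 0\<close> have coordinate sum at least 6 in modulus, hence a coordinate
  of modulus at least 2. For points \<open>i u + j v\<close> of the plane, the difference \<open>Y - Z = j (2 r - a / 2)\<close>
  depends on \<open>j\<close> alone, and \<open>\<bar>Y - Z\<bar> + \<bar>Y + Z\<bar> \<le> 2 \<mu>\<close>.\<close>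
lemma extremal_box_integer_points:
  fixes z :: "real^3"
  assumes ar: "0 < a" "a \<le> r" "r \<le> 2" and z: "z \<in> integer_lattice" "z \<in> form_box (extremal_forms a r) (\<lambda>_. \<mu>)"
  shows "z \<noteq> 0 \<Longrightarrow> a \<le> \<mu>" and "z $ 2 \<noteq> 0 \<or> z $ 3 \<noteq> 0 \<Longrightarrow> r \<le> \<mu>"
proof -
  obtain i j k :: int where ijk: "z $ 1 = i" "z $ 2 = j" "z $ 3 = k"
    using z(1) unfolding integer_lattice_iff_3 by (elim conjE Ints_cases)
  define X Y Z where "X = a * i - a / 2 * j + 2 * k" and "Y = - a / 2 * i + r * j + 2 * k"
    and "Z = - a / 2 * i + (a / 2 - r) * j + 2 * k"
  have b: "\<bar>X\<bar> \<le> \<mu>" "\<bar>Y\<bar> \<le> \<mu>" "\<bar>Z\<bar> \<le> \<mu>"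
    using z(2) by (simp_all add: form_box_def forall_3 row_eq_nth extremal_forms_def inner_vec_def sum_3
        ijk X_def Y_def Z_def mult.commute)
  have r: "r \<le> \<mu>" if "j \<noteq> 0 \<or> k \<noteq> 0"
  proof (cases "k = 0")
    case False
    have "X + Y + Z = 6 * k" by (simp add: X_def Y_def Z_def algebra_simps)
    then have "6 * \<bar>real_of_int k\<bar> \<le> 3 * \<mu>" using b by linarith
    moreover have "1 \<le> \<bar>real_of_int k\<bar>" using False by linarith
    ultimately show ?thesis using ar by linarith
  next
    case True
    then have j: "j \<noteq> 0" using that by simp
    have YZ: "Y - Z = j * (2 * r - a / 2)" "Y + Z = - X"
      using True by (simp_all add: X_def Y_def Z_def algebra_simps)
    have pos: "0 < 2 * r - a / 2" using ar by linarith
    have abs: "\<bar>j\<bar> * (2 * r - a / 2) \<le> \<bar>Y - Z\<bar>" unfolding YZ(1) abs_mult using pos by simp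
    show ?thesis
    proof (cases "\<bar>j\<bar> = 1")
      case True
      \<comment> \<open>For odd \<open>j\<close> the coordinate \<open>X = a (2 i - j) / 2\<close> cannot vanish; the bound \<open>a / 2\<close> for it makes up
        exactly for what \<open>\<bar>Y - Z\<bar>\<close> lacks to \<open>2 r\<close>.\<close>
      then have "1 \<le> \<bar>2 * i - j\<bar>" by presburger
      then have "1 \<le> \<bar>real_of_int (2 * i - j)\<bar>" by linarith
      then have "a / 2 * 1 \<le> a / 2 * \<bar>real_of_int (2 * i - j)\<bar>" using ar(1) by (intro mult_left_mono) auto
      also have "\<dots> = \<bar>a / 2 * real_of_int (2 * i - j)\<bar>" using ar(1) by (simp add: abs_mult)
      also have "a / 2 * real_of_int (2 * i - j) = X" using \<open>k = 0\<close> by (simp add: X_def algebra_simps)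
      finally have "a / 2 \<le> \<bar>X\<bar>" by simp
      moreover have "2 * r - a / 2 \<le> \<bar>Y - Z\<bar>" using abs True by simp
      ultimately show ?thesis using YZ(2) b by linarith
    next
      case False
      then have "2 \<le> \<bar>real_of_int j\<bar>" using j by linarith
      then have "2 * (2 * r - a / 2) \<le> \<bar>real_of_int j\<bar> * (2 * r - a / 2)"
        using pos by (intro mult_right_mono) auto
      then show ?thesis using abs b ar by simp
    qed
  qed
  then show "z $ 2 \<noteq> 0 \<or> z $ 3 \<noteq> 0 \<Longrightarrow> r \<le> \<mu>" by (simp add: ijk)
  assume "z \<noteq> 0"
  show "a \<le> \<mu>"
  proof (cases "j \<noteq> 0 \<or> k \<noteq> 0")
    case True
    then show ?thesis using r ar by linarith
  next
    case False
    then have "i \<noteq> 0" using \<open>z \<noteq> 0\<close> by (auto simp: vec_eq_iff forall_3 ijk)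
    then have "1 \<le> \<bar>real_of_int i\<bar>" by linarith
    then have "a * 1 \<le> a * \<bar>real_of_int i\<bar>" using ar(1) by (intro mult_left_mono) auto
    also have "\<dots> = \<bar>X\<bar>" using False ar(1) by (simp add: X_def abs_mult)
    finally show ?thesis using b by simp
  qed
qed

text \<open>All three minors of the first two columns equal the covolume 1, which puts the third unit vector
  on the boundary of the pseudo-compound. By the previous lemma every integer point of gauge
  less than \<open>r\<close> is a multiple of the first unit vector, so two independent points need gauge
  \<open>r\<close>.\<close>
lemma extremal_parallelepiped:
  assumes ar: "0 < a" "a \<le> r" "r \<le> 2" and covol: "a * r - a\<^sup>2 / 4 = 1"
  defines "P \<equiv> form_box (extremal_forms a r) (\<lambda>_. 1)"
  shows "symmetric_parallelepiped P"
    and "successive_minimum 1 (pseudo_compound P) integer_lattice \<le> 1"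
    and "a \<le> successive_minimum 1 P integer_lattice"
    and "r \<le> successive_minimum 2 P integer_lattice"
proof -
  define B where "B = extremal_forms a r"
  have "det B = 6 * (a * r - a\<^sup>2 / 4)"
    by (simp add: B_def extremal_forms_def det_3 power2_eq_square algebra_simps)
  then have B: "det B \<noteq> 0" using covol by simp
  then show "symmetric_parallelepiped P"
    unfolding symmetric_parallelepiped_iff_unit_box P_def B_def by blast
  have e: "minor_rows B $ i \<bullet> axis 3 1 = 1" for i
    using covol exhaust_3[of i]
    by (auto simp: inner_axis minor_rows_def cross3_def B_def extremal_forms_def power2_eq_square field_simps)
  have "{axis 3 1} \<subseteq> form_box (minor_rows B) (\<lambda>_. 1) \<inter> integer_lattice"
    by (simp add: form_box_def row_eq_nth e axis_in_integer_lattice)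
  then have "successive_minimum 1 (form_box (minor_rows B) (\<lambda>_. 1)) integer_lattice \<le> 1"
    by (intro successive_minimum_le[where S = "{axis 3 1}"]) (simp_all add: axis_eq_0_iff)
  then show "successive_minimum 1 (pseudo_compound P) integer_lattice \<le> 1"
    using pseudo_compound_unit_box[OF B] by (simp add: P_def B_def)
  note points = extremal_box_integer_points[OF ar]
  show "a \<le> successive_minimum 1 P integer_lattice"
    unfolding P_def
  proof (rule successive_minimum_ge[where ?S0.0 = "{axis 1 1}"])
    fix \<mu> and S :: "(real^3) set"
    assume S: "S \<subseteq> form_box (extremal_forms a r) (\<lambda>_. \<mu>) \<inter> integer_lattice" "independent S" "card S = 1"
    then obtain z where "S = {z}" by (metis card_1_singletonE)
    then show "a \<le> \<mu>" using S points(1)[of z \<mu>] by auto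
  qed (simp_all add: axis_in_integer_lattice axis_eq_0_iff)
  show "r \<le> successive_minimum 2 P integer_lattice"
    unfolding P_def
  proof (rule successive_minimum_ge[where ?S0.0 = "{axis 1 1, axis 2 1}"])
    show "{axis 1 1, axis 2 1 :: real^3} \<subseteq> integer_lattice" by (simp add: axis_in_integer_lattice)
    have "axis 1 1 \<times> axis 2 (1::real) \<noteq> 0" by (simp add: cross_basis axis_eq_0_iff)
    then show "independent {axis 1 1, axis 2 1 :: real^3}" "card {axis 1 1, axis 2 1 :: real^3} = 2"
      using independent_pair_iff_cross[of "axis 1 1" "axis 2 1"] by auto
    fix \<mu> and S :: "(real^3) set"
    assume S: "S \<subseteq> form_box (extremal_forms a r) (\<lambda>_. \<mu>) \<inter> integer_lattice" "independent S" "card S = 2"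
    then obtain x y where xy: "S = {x, y}" "x \<noteq> y" by (meson card_2_iff)
    show "r \<le> \<mu>"
    proof (rule ccontr)
      assume "\<not> r \<le> \<mu>"
      then have "z $ 2 = 0 \<and> z $ 3 = 0" if "z \<in> S" for z
        using points(2)[of z \<mu>] S(1) that by blast
      then have "x $ 2 = 0" "x $ 3 = 0" "y $ 2 = 0" "y $ 3 = 0" by (simp_all add: xy)
      then have "x \<times> y = 0" by (simp add: cross3_def vec_eq_iff forall_3)
      then show False using independent_pair_iff_cross[of x y] xy S(2) by blast
    qed
  qed
qed


theorem theorem3:
  shows "(\<forall>P :: (real^3) set. symmetric_parallelepiped P \<and>
            successive_minimum 1 (pseudo_compound P) integer_lattice \<le> 1 \<and>
            successive_minimum 1 P integer_lattice > 1 \<longrightarrow>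
            successive_minimum 1 P integer_lattice \<le> 2 / sqrt 3 \<and>
            successive_minimum 2 P integer_lattice \<le> 5 / 4) \<and>
         (\<forall>c < 2 / sqrt 3. \<exists>P :: (real^3) set. symmetric_parallelepiped P \<and>
            successive_minimum 1 (pseudo_compound P) integer_lattice \<le> 1 \<and>
            successive_minimum 1 P integer_lattice > 1 \<and>
            successive_minimum 1 P integer_lattice > c) \<and>
         (\<forall>c < 5 / 4. \<exists>P :: (real^3) set. symmetric_parallelepiped P \<and>
            successive_minimum 1 (pseudo_compound P) integer_lattice \<le> 1 \<and>
            successive_minimum 1 P integer_lattice > 1 \<and>
            successive_minimum 2 P integer_lattice > c)"
proof (intro conjI allI impI)
  fix c :: real assume c: "c < 2 / sqrt 3"
  define a where "a = 2 / sqrt 3"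
  have "sqrt 3 < 2" by (rule real_less_lsqrt) simp_all
  then have a1: "1 < a" by (simp add: a_def)
  have "1 \<le> sqrt 3" by simp
  then have a2: "a \<le> 2" by (simp add: a_def divide_le_eq)
  have covol: "a * a - a\<^sup>2 / 4 = 1" by (simp add: a_def power2_eq_square field_simps)
  have "0 < a" using a1 by simp
  note ex = extremal_parallelepiped[OF \<open>0 < a\<close> order_refl a2 covol]
  show "\<exists>P :: (real^3) set. symmetric_parallelepiped P \<and>
      successive_minimum 1 (pseudo_compound P) integer_lattice \<le> 1 \<and>
      successive_minimum 1 P integer_lattice > 1 \<and> successive_minimum 1 P integer_lattice > c"
    by (intro exI conjI, fact ex(1), fact ex(2), rule less_le_trans[OF a1 ex(3)],
        rule less_le_trans[OF c[folded a_def] ex(3)])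
next
  fix c :: real assume c: "c < 5 / 4"
  \<comment> \<open>The first minimum must exceed 1, so it is \<open>1 + e\<close>; the second is then at least \<open>5 / 4 - e\<close>. The bound
    \<open>1 / 10\<close> on \<open>e\<close> keeps \<open>a \<le> 2 / \<surd>3\<close>, which is what \<open>a \<le> r\<close> amounts to.\<close>
  define e where "e = min (1 / 10) ((5 / 4 - c) / 2)"
  have e: "0 < e" "e \<le> 1 / 10" "c < 5 / 4 - e" using c by (auto simp: e_def min_def field_simps)
  define a where "a = 1 + e"
  define r where "r = 1 / a + a / 4"
  have a: "1 < a" "a \<le> 11 / 10" using e by (simp_all add: a_def)
  have "a\<^sup>2 \<le> (11 / 10)\<^sup>2" using a by (intro power_mono) auto
  then have "a * (3 * a / 4) \<le> 1" by (simp add: power2_eq_square)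
  then have "3 * a / 4 \<le> 1 / a" using a by (simp add: le_divide_eq mult.commute)
  then have ar: "a \<le> r" by (simp add: r_def)
  have "1 / a \<le> 1" using a by simp
  then have r2: "r \<le> 2" using a unfolding r_def by linarith
  have "(1 - e) * a \<le> 1" by (simp add: a_def algebra_simps)
  then have "1 - e \<le> 1 / a" using a by (simp add: le_divide_eq)
  then have rc: "c < r" using e a unfolding r_def by linarith
  have covol: "a * r - a\<^sup>2 / 4 = 1" using a by (simp add: r_def power2_eq_square field_simps)
  have "0 < a" using a by simp
  note ex = extremal_parallelepiped[OF \<open>0 < a\<close> ar r2 covol]
  show "\<exists>P :: (real^3) set. symmetric_parallelepiped P \<and>
      successive_minimum 1 (pseudo_compound P) integer_lattice \<le> 1 \<and>
      successive_minimum 1 P integer_lattice > 1 \<and> successive_minimum 2 P integer_lattice > c"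
    by (intro exI conjI, fact ex(1), fact ex(2), rule less_le_trans[OF a(1) ex(3)],
        rule less_le_trans[OF rc ex(4)])
qed (elim conjE, rule successive_minima_upper_bounds, assumption+)+

end
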